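(* Let $G=(V,E)$ be a simple directed graph with independent edge propagation probabilities $p_e\in[0,1]$, $e\in E$. For $\boldsymbol\theta=(\theta_v)_{v\in V}\in[0,1]^V$ let $$F(\boldsymbol\theta)=\sum_{u\in V}\mathbb{P}_{\boldsymbol\theta}(\rho\rightsquigarrow u)$$ be the expected number of original vertices reachable from the artificial source $\rho$ in the random augmented graph with source-edge probabilities $\boldsymbol\theta$. Let $S\subseteq V$ and let $v\notin S$ (with $v\in V$). Then $$\frac{\partial F}{\partial\theta_v}(\mathbf 1_S)=\sigma(S\cup\{v\})-\sigma(S),$$ where $\mathbf 1_S\in\{0,1\}^V$ is the indicator vector of $S$ and $\sigma$ is the Independent Cascade influence spread.
   Context: Independent Cascade (IC) model, live-edge form: each edge $e\in E$ is independently live with probability $p_e$ and dead otherwise. A vertex is activated by a seed set $S\subseteq V$ if and only if it is reachable from some vertex of $S$ by a directed path (possibly of length zero) of live edges. $\sigma(S)$ is the expected number of vertices activated by $S$. Augmented random graph: add a new vertex $\rho\notin V$ and, for every $v\in V$, an artificial directed edge $\rho\to v$. Every original edge $e$ is live with probability $p_e$, every artificial edge $\rho\to v$ is live with probability $\theta_v$, and all these events are mutually independent. $\mathbb{P}_{\boldsymbol\theta}(\rho\rightsquigarrow u)$ is the probability that there is a directed path of live edges from $\rho$ to $u$. Since $F$ is defined on $[0,1]^V$ and the $v$-th coordinate of $\mathbf 1_S$ is $0$, the partial derivative is the derivative in $t\in[0,1]$ at $t=0$ (one-sided) of $t\mapsto F(\mathbf 1_S+t\,\mathbf e_v)$, with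 $\mathbf e_v$ the $v$-th standard basis vector. *)

theory Defs
  imports "HOL-Probability.Probability" "Graph_Theory.Digraph"
begin

definition live_pmf :: "('a, 'b) pre_digraph \<Rightarrow> ('b \<Rightarrow> real) \<Rightarrow> ('b \<Rightarrow> bool) pmf" where
  "live_pmf G p = Pi_pmf (arcs G) False (\<lambda>e. bernoulli_pmf (p e))"

definition live_subgraph :: "('a, 'b) pre_digraph \<Rightarrow> ('b \<Rightarrow> bool) \<Rightarrow> ('a, 'b) pre_digraph" where
  "live_subgraph G \<omega> = G\<lparr>arcs := {e \<in> arcs G. \<omega> e}\<rparr>"

definition activated :: "('a, 'b) pre_digraph \<Rightarrow> ('b \<Rightarrow> bool) \<Rightarrow> 'a set \<Rightarrow> 'a set" where
  "activated G \<omega> S = {u \<in> verts G. \<exists>s\<in>S. s \<rightarrow>\<^sup>*\<^bsub>live_subgraph G \<omega>\<^esub> u}"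

definition influence_spread :: "('a, 'b) pre_digraph \<Rightarrow> ('b \<Rightarrow> real) \<Rightarrow> 'a set \<Rightarrow> real" where
  "influence_spread G p S =
     measure_pmf.expectation (live_pmf G p) (\<lambda>\<omega>. real (card (activated G \<omega> S)))"

text \<open>
  The artificial source is \<^term>\<open>None\<close>, an original vertex \<open>v\<close> becomes \<open>Some v\<close>, an original arc
  \<open>e\<close> becomes \<open>Inl e\<close>, and \<open>Inr v\<close> is the artificial arc from the source to \<open>v\<close>.
\<close>
definition augment :: "('a, 'b) pre_digraph \<Rightarrow> ('a option, 'b + 'a) pre_digraph" where
  "augment G =
     \<lparr>verts = insert None (Some ` verts G),
      arcs = arcs G <+> verts G,
      tail = case_sum (\<lambda>e. Some (tail G e)) (\<lambda>v. None),
      head = case_sum (\<lambda>e. Some (head G e)) (\<lambda>v. Some v)\<rparr>"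

definition source_reach_prob ::
    "('a, 'b) pre_digraph \<Rightarrow> ('b \<Rightarrow> real) \<Rightarrow> ('a \<Rightarrow> real) \<Rightarrow> 'a \<Rightarrow> real" where
  "source_reach_prob G p \<theta> u =
     measure_pmf.prob (live_pmf (augment G) (case_sum p \<theta>))
       {\<omega>. None \<rightarrow>\<^sup>*\<^bsub>live_subgraph (augment G) \<omega>\<^esub> Some u}"

text \<open>
  Only arguments \<open>\<theta>\<close> with values in \<open>[0, 1]\<close> are meaningful: \<^const>\<open>bernoulli_pmf\<close> truncates its
  parameter to that interval, so derivatives at the boundary have to be taken within \<open>[0, 1]\<close>.
\<close>
definition expected_source_reach ::
    "('a, 'b) pre_digraph \<Rightarrow> ('b \<Rightarrow> real) \<Rightarrow> ('a \<Rightarrow> real) \<Rightarrow> real" where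
  "expected_source_reach G p \<theta> = (\<Sum>u\<in>verts G. source_reach_prob G p \<theta> u)"

end

(*
  The arcs out of the source and the original arcs are independent, and a vertex is reachable from
  the source iff it is activated by the heads of the live source arcs. Hence F is the multilinear
  extension of the influence spread: F(theta) is the expected spread of the random seed set that
  contains each w independently with probability theta_w. Along 1_S + t e_v this seed set is
  S with probability 1 - t and S + v with probability t, so F is affine in t.
*)
theory Submission
  imports Defs
begin

text \<open>The product mass of \<open>h\<close> splits into the masses of
  \<open>h \<circ> Inl\<close> and \<open>h \<circ> Inr\<close>, and gluing by
  \<open>case_sum\<close> is injective. The bind form serves to condition on the
  \<open>B\<close>-part, which will be the artificial arcs.\<close>

lemma Pi_pmf_Plus:
  assumes "finite A" "finite B"
  shows "Pi_pmf (A <+> B) d (case_sum p q) =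
           bind_pmf (Pi_pmf B d q) (\<lambda>g. map_pmf (\<lambda>f. case_sum f g) (Pi_pmf A d p))"
proof -
  have inj: "inj (\<lambda>(f :: 'a \<Rightarrow> 'c, g :: 'b \<Rightarrow> 'c). case_sum f g)"
    by (auto simp: inj_on_def fun_eq_iff split: sum.splits)
  have "Pi_pmf (A <+> B) d (case_sum p q) =
          map_pmf (\<lambda>(f, g). case_sum f g) (pair_pmf (Pi_pmf A d p) (Pi_pmf B d q))"
    (is "_ = ?R")
  proof (rule pmf_eqI)
    fix h :: "'a + 'b \<Rightarrow> 'c"
    have h: "h = (\<lambda>(f, g). case_sum f g) (h \<circ> Inl, h \<circ> Inr)"
      by (auto simp: fun_eq_iff split: sum.splits)
    have "pmf ?R h = pmf (pair_pmf (Pi_pmf A d p) (Pi_pmf B d q)) (h \<circ> Inl, h \<circ> Inr)"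
      by (subst h) (rule pmf_map_inj'[OF inj])
    also have "\<dots> = pmf (Pi_pmf (A <+> B) d (case_sum p q)) h"
      using assms
      by (auto simp: pmf_pair pmf_Pi prod.Plus o_def split: sum.splits)
        (metis InlI InrI obj_sumE Inl_inject Inr_inject Inl_Inr_False PlusE)+
    finally show "pmf (Pi_pmf (A <+> B) d (case_sum p q)) h = pmf ?R h" by simp
  qed
  then show ?thesis
    \<comment> \<open>Commuting the pair makes \<open>g\<close> the outer draw.\<close>
    by (subst (asm) pair_commute_pmf)
      (simp add: pair_pmf_def map_pmf_def bind_assoc_pmf bind_return_pmf)
qed

lemma arcs_ends_live_augment:
  "arcs_ends (live_subgraph (augment G) (case_sum \<omega> \<eta>)) =
     map_prod Some Some ` arcs_ends (live_subgraph G \<omega>) \<union>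
     {(None, Some w) | w. w \<in> verts G \<and> \<eta> w}"
  by (force simp: arcs_ends_def arc_to_ends_def live_subgraph_def augment_def image_iff
      split: sum.splits)

text \<open>No arc enters \<open>None\<close>, so a live path from the source to
  \<open>Some u\<close> is one live artificial arc followed by a live path of original arcs.\<close>

lemma source_reachable_iff_activated:
  "None \<rightarrow>\<^sup>*\<^bsub>live_subgraph (augment G) (case_sum \<omega> \<eta>)\<^esub> Some u \<longleftrightarrow> u \<in> activated G \<omega> {w. \<eta> w}"
  (is "reachable ?A _ _ \<longleftrightarrow> _")
proof
  have verts: "verts ?A = insert None (Some ` verts G)"
    "verts (live_subgraph G \<omega>) = verts G"
    by (simp_all add: live_subgraph_def augment_def)
  {
    fix x assume "None \<rightarrow>\<^sup>*\<^bsub>?A\<^esub> x"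
    \<comment> \<open>The endpoint is left general for the induction; its base case
      \<open>x = None\<close> is vacuous, and a step out of \<open>None\<close> supplies the
      seed.\<close>
    then have "\<forall>u. x = Some u \<longrightarrow> u \<in> activated G \<omega> {w. \<eta> w}"
      unfolding reachable_def
    proof (induction rule: rtrancl_on_induct)
      case (step y z)
      then show ?case
        by (auto simp: arcs_ends_live_augment verts activated_def reachable_def
            intro: rtrancl_on_into_rtrancl_on)
    qed simp
  }
  then show "None \<rightarrow>\<^sup>*\<^bsub>?A\<^esub> Some u \<Longrightarrow> u \<in> activated G \<omega> {w. \<eta> w}" by blast
  assume "u \<in> activated G \<omega> {w. \<eta> w}"
  then obtain s where "\<eta> s"
    and "(s, u) \<in> rtrancl_on (verts G) (arcs_ends (live_subgraph G \<omega>))"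
    by (auto simp: activated_def reachable_def verts)
  from this(2,1) show "None \<rightarrow>\<^sup>*\<^bsub>?A\<^esub> Some u"
    unfolding reachable_def
  proof (induction rule: rtrancl_on_induct)
    case base
    then show ?case
      by (auto simp: arcs_ends_live_augment verts
          intro!: rtrancl_on_into_rtrancl_on[OF rtrancl_on_refl])
  next
    case (step y z)
    then show ?case
      by (auto simp: arcs_ends_live_augment verts intro!: rtrancl_on_into_rtrancl_on[of _ "Some y"])
  qed
qed

text \<open>Finite support turns the expectations below into finite sums.\<close>

lemma finite_set_Pi_pmf_bool:
  fixes q :: "'a \<Rightarrow> bool pmf"
  shows "finite A \<Longrightarrow> finite (set_pmf (Pi_pmf A d q))"
  by (simp add: set_Pi_pmf finite_PiE_dflt)

text \<open>Linearity of expectation turns the sum of probabilities into the expected number of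
  reached vertices; given the artificial arcs \<open>\<eta>\<close>, that number is the size of the
  cascade seeded by \<open>{w. \<eta> w}\<close>.\<close>

lemma expected_source_reach_eq_multilinear_extension:
  assumes fin: "finite (verts G)" "finite (arcs G)"
  shows "expected_source_reach G p \<theta> =
    measure_pmf.expectation (Pi_pmf (verts G) False (\<lambda>w. bernoulli_pmf (\<theta> w)))
      (\<lambda>\<eta>. influence_spread G p {w. \<eta> w})"
proof -
  let ?N = "live_pmf (augment G) (case_sum p \<theta>)"
  let ?M = "Pi_pmf (verts G) False (\<lambda>w. bernoulli_pmf (\<theta> w))"
  let ?R = "\<lambda>\<omega>. {u \<in> verts G. None \<rightarrow>\<^sup>*\<^bsub>live_subgraph (augment G) \<omega>\<^esub> Some u}"
  \<comment> \<open>\<open>live_pmf\<close> applies \<open>bernoulli_pmf\<close> after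
    \<open>case_sum\<close>, whereas \<open>Pi_pmf_Plus\<close> expects a \<open>case_sum\<close> of
    marginals.\<close>
  have "case_sum (\<lambda>e. bernoulli_pmf (p e)) (\<lambda>w. bernoulli_pmf (\<theta> w)) =
      (\<lambda>e. bernoulli_pmf (case_sum p \<theta> e))"
    by (auto simp: fun_eq_iff split: sum.splits)
  then have N: "?N = bind_pmf ?M (\<lambda>\<eta>. map_pmf (\<lambda>\<omega>. case_sum \<omega> \<eta>) (live_pmf G p))"
    using Pi_pmf_Plus[OF fin(2,1), of False "\<lambda>e. bernoulli_pmf (p e)" "\<lambda>w. bernoulli_pmf (\<theta> w)"]
    by (simp add: live_pmf_def augment_def)
  have finM: "finite (set_pmf ?M)" and finL: "finite (set_pmf (live_pmf G p))"
    using fin by (simp_all add: finite_set_Pi_pmf_bool live_pmf_def)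
  have R: "?R (case_sum \<omega> \<eta>) = activated G \<omega> {w. \<eta> w}" for \<omega> \<eta>
    unfolding source_reachable_iff_activated by (auto simp: activated_def)
  have "expected_source_reach G p \<theta> =
      (\<Sum>u\<in>verts G. measure_pmf.expectation ?N
         (indicator {\<omega>. None \<rightarrow>\<^sup>*\<^bsub>live_subgraph (augment G) \<omega>\<^esub> Some u}))"
    by (simp add: expected_source_reach_def source_reach_prob_def)
  also have "\<dots> = measure_pmf.expectation ?N (\<lambda>\<omega>. \<Sum>u\<in>verts G.
         indicator {\<omega>. None \<rightarrow>\<^sup>*\<^bsub>live_subgraph (augment G) \<omega>\<^esub> Some u} \<omega>)"
    by (rule Bochner_Integration.integral_sum[symmetric])
      (simp add: measure_pmf.emeasure_eq_measure)
  also have "\<dots> = measure_pmf.expectation ?N (\<lambda>\<omega>. real (card (?R \<omega>)))"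
    using fin by (simp add: indicator_def sum.If_cases Int_def)
  also have "\<dots> = (\<Sum>\<eta>\<in>set_pmf ?M. pmf ?M \<eta> *\<^sub>R
      measure_pmf.expectation (map_pmf (\<lambda>\<omega>. case_sum \<omega> \<eta>) (live_pmf G p)) (\<lambda>\<omega>. real (card (?R \<omega>))))"
    unfolding N using finM finL by (intro pmf_expectation_bind) auto
  also have "\<dots> = (\<Sum>\<eta>\<in>set_pmf ?M. pmf ?M \<eta> *\<^sub>R influence_spread G p {w. \<eta> w})"
    by (simp add: influence_spread_def R)
  also have "\<dots> = measure_pmf.expectation ?M (\<lambda>\<eta>. influence_spread G p {w. \<eta> w})"
    using finM by (subst integral_measure_pmf[of "set_pmf ?M"]) auto
  finally show ?thesis .
qed

lemma bernoulli_pmf_0: "bernoulli_pmf 0 = return_pmf False"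
  and bernoulli_pmf_1: "bernoulli_pmf 1 = return_pmf True"
  by (rule pmf_eqI; case_tac i; simp)+

text \<open>Every coordinate of \<open>A\<close> except \<open>v\<close> has parameter 0 or 1 and is
  deterministic. As \<open>v \<notin> S\<close>, the coordinate \<open>v\<close> has parameter
  exactly \<open>t\<close>.\<close>

lemma Pi_pmf_bernoulli_indicator_direction:
  assumes "finite A" "S \<subseteq> A" "v \<in> A" "v \<notin> S"
  shows "Pi_pmf A False (\<lambda>w. bernoulli_pmf (indicator S w + t * indicator {v} w)) =
    map_pmf (\<lambda>b w. w \<in> S \<or> b \<and> w = v) (bernoulli_pmf t)"
proof -
  have "Pi_pmf (A - {v}) False (\<lambda>w. bernoulli_pmf (indicator S w + t * indicator {v} w)) =
      Pi_pmf (A - {v}) False (\<lambda>w. return_pmf (w \<in> S))"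
    by (rule Pi_pmf_cong) (auto simp: indicator_def bernoulli_pmf_0 bernoulli_pmf_1)
  \<comment> \<open>Outside \<open>A - {v}\<close> the default \<open>False\<close> agrees with
    \<open>w \<in> S\<close>, because \<open>S \<subseteq> A\<close> and
    \<open>v \<notin> S\<close>.\<close>
  also have "\<dots> = return_pmf (\<lambda>w. w \<in> S)"
    using assms by (auto simp: fun_eq_iff)
  finally have rest: "Pi_pmf (A - {v}) False
      (\<lambda>w. bernoulli_pmf (indicator S w + t * indicator {v} w)) = return_pmf (\<lambda>w. w \<in> S)" .
  have "Pi_pmf (insert v (A - {v})) False
      (\<lambda>w. bernoulli_pmf (indicator S w + t * indicator {v} w)) =
    map_pmf (\<lambda>b w. w \<in> S \<or> b \<and> w = v) (bernoulli_pmf t)"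
    using assms
    by (subst Pi_pmf_insert')
      (auto simp: rest bind_return_pmf map_pmf_def fun_eq_iff intro!: bind_pmf_cong)
  then show ?thesis using assms by (simp add: insert_absorb)
qed

theorem theorem4p1:
  fixes G :: "('a, 'b) pre_digraph"
    and p :: "'b \<Rightarrow> real"
    and S :: "'a set"
    and v :: 'a
  assumes "digraph G"
    and "\<And>e. e \<in> arcs G \<Longrightarrow> p e \<in> {0..1}"
    and "S \<subseteq> verts G"
    and "v \<in> verts G"
    and "v \<notin> S"
  shows "((\<lambda>t. expected_source_reach G p (\<lambda>w. indicator S w + t * indicator {v} w))
           has_real_derivative (influence_spread G p (S \<union> {v}) - influence_spread G p S))
         (at 0 within {0..1})"
proof -
  interpret digraph G by fact
  have S: "{w. w \<in> S \<or> w = v} = S \<union> {v}" by auto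
  \<comment> \<open>The range of \<open>t\<close> matters: outside it \<open>bernoulli_pmf\<close>
    truncates its parameter.\<close>
  have affine: "expected_source_reach G p (\<lambda>w. indicator S w + t * indicator {v} w) =
      influence_spread G p (S \<union> {v}) * t + influence_spread G p S * (1 - t)"
    if "t \<in> {0..1}" for t
    using that assms(3-5)
    by (simp add: expected_source_reach_eq_multilinear_extension S
        Pi_pmf_bernoulli_indicator_direction del: Un_insert_right)
  have "((\<lambda>t. influence_spread G p (S \<union> {v}) * t + influence_spread G p S * (1 - t))
      has_real_derivative (influence_spread G p (S \<union> {v}) - influence_spread G p S))
      (at 0 within {0..1})"
    by (auto intro!: derivative_eq_intros)
  then show ?thesis
    \<comment> \<open>Agreement on \<open>{0..1}\<close> suffices for the derivative within that
      set; the radius 1 is an arbitrary positive choice.\<close>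
    by (rule has_field_derivative_transform_within[OF _ zero_less_one]) (simp_all add: affine)
qed

end
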